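(* Let $$S(z,q)=\sum_{n=1}^\infty \frac{q^n (q^{n+1};q)_\infty}{(zq^n;q)_\infty (z^{-1}q^n;q)_\infty}.$$ Then $$(z;q)_\infty (z^{-1};q)_\infty (q;q)_\infty\, S(z,q)=\sum_{n=0}^\infty\sum_{m=0}^n \left(1-z^{\frac12(n-m)}\right)^2 z^{\frac12(m-n)}\left(\frac{-4}{n}\right)\left(\frac{12}{m}\right) q^{\frac1{12}\left(\frac{3n^2-m^2}{2}-1\right)}$$ as an identity in $\mathbb{Z}[z,z^{-1}][[q]]$.
   Context: Notation: $(a;q)_\infty=\prod_{k\ge 0}(1-aq^k)$. $\left(\frac{\cdot}{\cdot}\right)$ is the Kronecker symbol: $\left(\frac{-4}{n}\right)$ is $1$ if $n\equiv1\pmod 4$, $-1$ if $n\equiv 3\pmod 4$, and $0$ if $n$ is even; $\left(\frac{12}{m}\right)$ is $1$ if $m\equiv\pm1\pmod{12}$, $-1$ if $m\equiv\pm5\pmod{12}$, and $0$ otherwise. Terms in which a Kronecker symbol vanishes are zero; in all other terms $n$ and $m$ are odd and the exponents of $z$ and $q$ are integers. $S(z,q)$ is the generating function of the spt-crank. *)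

theory Defs
  imports
    "HOL-Analysis.Infinite_Products"
    "HOL-Computational_Algebra.Formal_Power_Series"
    "HOL-Library.Poly_Mapping"
begin

unbundle fps_syntax and no vec_syntax

text \<open>
  \<open>int \<Rightarrow>\<^sub>0 int\<close> with the convolution product is the group ring of the integers over the
  integers, i.e. the Laurent polynomial ring in one variable \<open>z\<close>, where \<open>z\<close> to the power \<open>k\<close>
  is the finitely supported map \<open>single k 1\<close>. The variable \<open>q\<close> is \<open>fps_X\<close>; infinite sums and
  products of power series are limits in the library's metric on \<open>fps\<close> (the \<open>q\<close>-adic one,
  in which a sequence converges iff each coefficient is eventually constant).
\<close>

type_synonym laurent = "int \<Rightarrow>\<^sub>0 int"

definition zpow :: "int \<Rightarrow> laurent fps" where
  "zpow k = fps_const (Poly_Mapping.single k 1)"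

abbreviation q :: "laurent fps" where
  "q \<equiv> fps_X"

definition qpoch_inf :: "laurent fps \<Rightarrow> laurent fps" where
  "qpoch_inf a = prodinf (\<lambda>k. 1 - a * q ^ k)"

text \<open>
  Laurent polynomials have no \<open>inverse\<close> operation, so neither do power series over them;
  \<open>fps_right_inverse f 1\<close> is the inverse of a power series \<open>f\<close> with constant coefficient 1
  (see \<open>spt_denominator\<close> below).
\<close>

definition spt_term :: "nat \<Rightarrow> laurent fps" where
  "spt_term n =
     q ^ n * qpoch_inf (q ^ (n + 1)) *
     fps_right_inverse (qpoch_inf (zpow 1 * q ^ n) * qpoch_inf (zpow (-1) * q ^ n)) 1"

definition spt_crank_gf :: "laurent fps" where
  "spt_crank_gf = suminf (\<lambda>n. spt_term (n + 1))"

definition kronecker_minus4 :: "nat \<Rightarrow> int" where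
  "kronecker_minus4 n = (if n mod 4 = 1 then 1 else if n mod 4 = 3 then -1 else 0)"

definition kronecker_12 :: "nat \<Rightarrow> int" where
  "kronecker_12 m =
     (if m mod 12 \<in> {1, 11} then 1 else if m mod 12 \<in> {5, 7} then -1 else 0)"

text \<open>
  If both symbols are nonzero and \<open>m \<le> n\<close>, all divisions and natural-number subtractions
  below are exact (see \<open>hecke_exponents\<close>); in all other cases the value is 0.
\<close>

definition hecke_term :: "nat \<Rightarrow> nat \<Rightarrow> laurent fps" where
  "hecke_term n m =
     (1 - zpow ((int n - int m) div 2)) ^ 2 * zpow ((int m - int n) div 2) *
     of_int (kronecker_minus4 n) * of_int (kronecker_12 m) *
     q ^ (((3 * n ^ 2 - m ^ 2) div 2 - 1) div 12)"


subsection \<open>Well-definedness\<close>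

lemma qpoch_inf_aux:
  assumes "fps_nth a 0 \<noteq> 1"
  shows "(\<lambda>k. 1 - a * q ^ k) has_prod qpoch_inf a" and "fps_nth (qpoch_inf a) 0 = 1 - fps_nth a 0"
proof -
  define P where "P n = (\<Prod>k\<le>n. 1 - a * q ^ k)" for n
  have step: "P (Suc n) $ k = P n $ k" if "k \<le> n" for n k
  proof -
    have "P (Suc n) = P n - (P n * a) * q ^ Suc n"
      unfolding P_def by (simp add: algebra_simps)
    moreover have "((P n * a) * q ^ Suc n) $ k = 0"
      using that by (subst fps_X_power_mult_right_nth) auto
    ultimately show ?thesis by simp
  qed
  have stable: "P n $ k = P k $ k" if "k \<le> n" for n k
    using that by (induction n rule: dec_induct) (simp_all add: step)
  define L where "L = Abs_fps (\<lambda>k. P k $ k)"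
  have lim: "P \<longlonglongrightarrow> L"
    unfolding tendsto_fps_iff L_def fps_nth_Abs_fps
    by (intro allI eventually_sequentiallyI) (rule stable)
  have L0: "L $ 0 = 1 - a $ 0"
    by (simp add: L_def P_def)
  with assms have "L \<noteq> 0" by auto
  with lim have hp: "(\<lambda>k. 1 - a * q ^ k) has_prod L"
    by (simp add: has_prod_def raw_has_prod_def P_def [abs_def])
  moreover have "qpoch_inf a = L"
    unfolding qpoch_inf_def prodinf_def
  proof (rule the_equality)
    fix p assume p: "(\<lambda>k. 1 - a * q ^ k) has_prod p"
    have "1 - a * q ^ i \<noteq> 0" for i
    proof
      assume "1 - a * q ^ i = 0"
      hence "P i = 0" by (auto simp: P_def)
      thus False using stable[of 0 i] L0 assms by (simp add: L_def)
    qed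
    with p have "P \<longlonglongrightarrow> p"
      by (simp add: has_prod_def raw_has_prod_def P_def [abs_def])
    thus "p = L" using lim LIMSEQ_unique by blast
  qed (rule hp)
  ultimately show "(\<lambda>k. 1 - a * q ^ k) has_prod qpoch_inf a"
    "fps_nth (qpoch_inf a) 0 = 1 - fps_nth a 0" using L0 by simp_all
qed

lemma qpoch_inf_zpow_has_prod:
  assumes "j \<noteq> 0 \<or> n > 0"
  shows "(\<lambda>k. 1 - (zpow j * q ^ n) * q ^ k) has_prod qpoch_inf (zpow j * q ^ n)"
proof (rule qpoch_inf_aux(1))
  have "Poly_Mapping.single j (1::int) \<noteq> 1" if "j \<noteq> 0"
    using that by (auto dest!: arg_cong[where f = "\<lambda>p. Poly_Mapping.lookup p j"]
      simp: lookup_one when_def)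
  thus "fps_nth (zpow j * q ^ n) 0 \<noteq> 1"
    using assms by (cases n) (auto simp: zpow_def fps_X_power_nth)
qed

lemma qpoch_inf_q_has_prod:
  "(\<lambda>k. 1 - q ^ (n + 1) * q ^ k) has_prod qpoch_inf (q ^ (n + 1))"
  by (rule qpoch_inf_aux(1)) (simp add: fps_X_power_nth)

lemma spt_denominator:
  assumes "n > 0"
  defines "D \<equiv> qpoch_inf (zpow 1 * q ^ n) * qpoch_inf (zpow (-1) * q ^ n)"
  shows "D * fps_right_inverse D 1 = 1"
proof (rule fps_right_inverse)
  have z: "fps_nth (zpow j * q ^ n) 0 = 0" for j
    using assms(1) by (simp add: zpow_def fps_X_power_nth)
  have "fps_nth (qpoch_inf (zpow j * q ^ n)) 0 = 1" for j
    by (subst qpoch_inf_aux(2)) (simp_all only: z, simp_all)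
  thus "fps_nth D 0 * 1 = 1"
    by (simp add: D_def)
qed

lemma fps_summable:
  fixes f :: "nat \<Rightarrow> laurent fps"
  assumes "\<And>n k. B k < n \<Longrightarrow> f n $ k = 0"
  shows "summable f"
proof -
  have "(\<lambda>n. \<Sum>i<n. f i) \<longlonglongrightarrow> Abs_fps (\<lambda>k. \<Sum>i\<le>B k. f i $ k)"
    unfolding tendsto_fps_iff
  proof
    fix k
    have "(\<Sum>i<n. f i) $ k = (\<Sum>i\<le>B k. f i $ k)" if "n \<ge> Suc (B k)" for n
      unfolding fps_sum_nth
      by (rule sum.mono_neutral_right) (use that assms in auto)
    thus "\<forall>\<^sub>F n in sequentially.
            (\<Sum>i<n. f i) $ k = Abs_fps (\<lambda>k. \<Sum>i\<le>B k. f i $ k) $ k"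
      by (auto intro: eventually_sequentiallyI[of "Suc (B k)"])
  qed
  thus ?thesis
    by (auto simp: summable_def sums_def)
qed

lemma spt_summable: "summable (\<lambda>n. spt_term (n + 1))"
  by (rule fps_summable[where B = id])
     (simp add: spt_term_def mult.assoc fps_X_power_mult_nth del: power_Suc)

lemma hecke_exponents:
  assumes "kronecker_minus4 n \<noteq> 0" "kronecker_12 m \<noteq> 0" "m \<le> n"
  shows "2 * ((int n - int m) div 2) = int n - int m"
    and "2 * ((int m - int n) div 2) = int m - int n"
    and "24 * int (((3 * n ^ 2 - m ^ 2) div 2 - 1) div 12) = 3 * int n ^ 2 - int m ^ 2 - 2"
    and "n \<le> 12 * (((3 * n ^ 2 - m ^ 2) div 2 - 1) div 12) + 1"
proof -
  have n4: "n mod 4 = 1 \<or> n mod 4 = 3"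
    using assms(1) by (auto simp: kronecker_minus4_def split: if_splits)
  have m12: "m mod 12 = 1 \<or> m mod 12 = 5 \<or> m mod 12 = 7 \<or> m mod 12 = 11"
    using assms(2) by (auto simp: kronecker_12_def split: if_splits)
  have "even (int n - int m)"
    using n4 m12 by presburger
  thus "2 * ((int n - int m) div 2) = int n - int m"
    "2 * ((int m - int n) div 2) = int m - int n"
    by presburger+
  define a b r s where "a = n div 4" and "b = m div 12" and "r = n mod 4" and "s = m mod 12"
  have n: "n = 4 * a + r" and m: "m = 12 * b + s"
    by (simp_all add: a_def b_def r_def s_def)
  have mod24: "(24 * t + u) mod 24 = u mod 24" for t u :: nat
    by simp
  have "3 * n ^ 2 = 24 * (2 * a ^ 2 + a * r) + 3 * r ^ 2"
    unfolding n by (simp add: power2_eq_square algebra_simps)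
  moreover have "(3 * r ^ 2) mod 24 = 3"
    using n4 by (auto simp: r_def)
  ultimately have n24: "(3 * n ^ 2) mod 24 = 3"
    by (simp only: mod24)
  have "m ^ 2 = 24 * (6 * b ^ 2 + b * s) + s ^ 2"
    unfolding m by (simp add: power2_eq_square algebra_simps)
  moreover have "s ^ 2 mod 24 = 1"
    using m12 by (auto simp: s_def)
  ultimately have m24: "(m ^ 2) mod 24 = 1"
    by (simp only: mod24)
  have le: "m ^ 2 \<le> n ^ 2"
    using assms(3) by (rule power_mono) simp
  define N M where "N = n ^ 2" and "M = m ^ 2"
  define x y where "x = 3 * N div 24" and "y = M div 24"
  have x: "3 * N = 24 * x + 3" and y: "M = 24 * y + 1"
    using n24 m24 div_mult_mod_eq[of "3 * N" 24] div_mult_mod_eq[of M 24]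
    unfolding x_def y_def by (simp_all add: N_def M_def)
  have "M \<le> N"
    using le by (simp add: N_def M_def)
  with x y have "y \<le> x" by linarith
  with x y have "3 * N - M = 2 * (12 * (x - y) + 1)"
    by simp
  hence E: "((3 * N - M) div 2 - 1) div 12 = x - y"
    by simp
  have *: "24 * (((3 * N - M) div 2 - 1) div 12) + M + 2 = 3 * N"
    unfolding E using x y \<open>y \<le> x\<close> by simp
  hence "int (24 * (((3 * N - M) div 2 - 1) div 12) + M + 2) = int (3 * N)"
    by (simp only:)
  thus "24 * int (((3 * n ^ 2 - m ^ 2) div 2 - 1) div 12) = 3 * int n ^ 2 - int m ^ 2 - 2"
    by (simp add: N_def M_def del: of_nat_div of_nat_diff)
  have "n \<le> N"
    by (simp add: N_def power2_eq_square)
  with * le show "n \<le> 12 * (((3 * n ^ 2 - m ^ 2) div 2 - 1) div 12) + 1"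
    unfolding N_def [symmetric] M_def [symmetric] by linarith
qed

lemma hecke_summable: "summable (\<lambda>n. \<Sum>m=0..n. hecke_term n m)"
proof (rule fps_summable[where B = "\<lambda>k. 12 * k + 1"])
  fix n k :: nat
  assume k: "12 * k + 1 < n"
  have "hecke_term n m $ k = 0" if "m \<le> n" for m
  proof (cases "kronecker_minus4 n = 0 \<or> kronecker_12 m = 0")
    case True
    thus ?thesis by (auto simp: hecke_term_def)
  next
    case False
    hence "k < ((3 * n ^ 2 - m ^ 2) div 2 - 1) div 12"
      using hecke_exponents(4)[of n m] that k by linarith
    thus ?thesis
      unfolding hecke_term_def by (subst fps_X_power_mult_right_nth) simp
  qed
  thus "(\<Sum>m=0..n. hecke_term n m) $ k = 0"
    by (simp add: fps_sum_nth)
qed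

end

(*
  For N > 0 the product of the infinite q-Pochhammer symbols of z, 1/z and q with the N-th summand
  of S is (q)_oo^2 q^N (z)_N (1/z)_N / (q)_N. By a finite form of the Jacobi triple product,
  (z)_N (1/z)_N is a combination of z^k + z^-k with explicit q-hypergeometric coefficients; it
  vanishes at z = 1, so it is a combination of z^k - 2 + z^-k for k = 1, ..., N. Up to a sign and a
  power of q, the coefficient of z^k - 2 + z^-k in the whole left-hand side is
    F_k = (q)_oo^2 (1 + q^k) sum_r q^r (q)_(2k+2r-1) / ((q)_(k+r-1) (q)_r (q)_(2k+r)).
  Creative telescoping gives F_k = 1 - q^(2k+2) + q^(3k+4) F_(k+2), and iterating this yields
    F_k = sum_j q^(3j^2+j+3jk) (1 - q^(4j+2+2k)).
  These are the Hecke terms with n = m + 2k, for m = 6j+1 and m = 6j+5.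
*)

theory Submission
  imports Defs
begin

subsection \<open>The finite triple product\<close>

text \<open>The q-Pochhammer symbol (q;q)_n; there is no division by (1-q)^n.\<close>

definition qfac :: "nat \<Rightarrow> 'a::comm_ring_1 fps" where
  "qfac n = (\<Prod>i=1..n. 1 - fps_X ^ i)"

text \<open>The reciprocal of (q;q)_m. The integer argument admits the usual convention that it is 0
  for m < 0, which cuts off the sums below at their natural boundaries.\<close>

definition qinv :: "int \<Rightarrow> 'a::comm_ring_1 fps" where
  "qinv m = (if m < 0 then 0 else fps_right_inverse (qfac (nat m)) 1)"

lemma qfac_Suc: "qfac (Suc n) = qfac n * (1 - fps_X ^ Suc n)"
  by (simp add: qfac_def)

lemma qfac_nth_0: "fps_nth (qfac n) 0 = 1"
  by (induction n) (simp_all add: qfac_def)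

lemma qfac_qinv: "qfac n * qinv (int n) = 1"
  unfolding qinv_def by (simp add: fps_right_inverse qfac_nth_0)

lemma qinv_neg: "m < 0 \<Longrightarrow> qinv m = 0"
  by (simp add: qinv_def)

text \<open>For m \<le> 0 both sides are 0, since \<open>nat m\<close> is 0 and the factor becomes 1
  - q^0; so the relation also holds across the boundary.\<close>

lemma qinv_pred: "qinv (m - 1) = (1 - fps_X ^ nat m) * qinv m"
proof (cases "m \<le> 0")
  case True
  thus ?thesis by (auto simp: qinv_def)
next
  case False
  then obtain n where m: "m = int (Suc n)"
    by (metis not_le pos_int_cases Suc_pred')
  have "qinv (int n) = qinv (int n) * (qfac (Suc n) * qinv (int (Suc n)) :: 'a fps)"
    by (simp add: qfac_qinv del: of_nat_Suc)
  also have "\<dots> = (qfac n * qinv (int n)) * ((1 - fps_X ^ Suc n) * qinv (int (Suc n)))"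
    by (simp add: qfac_Suc mult_ac del: of_nat_Suc)
  finally show ?thesis
    unfolding m nat_int by (simp add: qfac_qinv)
qed

lemma qinv_of_nat: "qinv (int n) = (1 - fps_X ^ Suc n) * qinv (int (Suc n))"
  using qinv_pred[of "int (Suc n)", where 'a = 'a] unfolding nat_int by simp

text \<open>
  The coefficient of \<open>z\<^sup>k\<close> and of \<open>z\<^sup>-\<^sup>k\<close> in \<open>(z)\<^sub>N (1/z)\<^sub>N\<close> for \<open>N > 0\<close>, see
  \<open>finite_triple_product\<close>; for \<open>k = 0\<close> it is the constant coefficient, not half of it.
\<close>

definition zcoeff :: "nat \<Rightarrow> nat \<Rightarrow> 'a::comm_ring_1 fps" where
  "zcoeff N k = (-1) ^ k * fps_X ^ (k choose 2) * (1 + fps_X ^ k) * qfac (2 * N - 1) *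
     (1 - fps_X ^ N) * qinv (int N - int k) * qinv (int N + int k)"

lemma choose_two_Suc: "Suc k choose 2 = (k choose 2) + k"
  by (simp add: numeral_2_eq_2)

lemma qfac_double_step:
  assumes "N > 0"
  shows "qfac (2 * Suc N - 1) =
    qfac (2 * N - 1) * (1 - (fps_X ^ N)^2) * (1 - fps_X * (fps_X ^ N)^2)"
proof -
  obtain M where "N = Suc M" using assms by (cases N) auto
  hence "2 * Suc N - 1 = Suc (2 * N)" "2 * N = Suc (2 * N - 1)" by auto
  hence "qfac (2 * Suc N - 1) =
    qfac (2 * N - 1) * (1 - fps_X ^ (2 * N)) * (1 - fps_X ^ Suc (2 * N) :: 'a fps)"
    by (metis qfac_Suc)
  thus ?thesis
    by (simp add: power_even_eq)
qed

text \<open>The comparison of coefficients of z^(k+1) required by the multiplication with (1 - z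
  q^N)(1 - q^N/z) = 1 + q^(2N) - q^N (z + 1/z). Once the common \<open>qinv\<close> factors are
  taken out, it is a polynomial identity in q, q^k and q^(N-k-1).\<close>

lemma zcoeff_step_Suc:
  assumes "N > 0"
  shows "zcoeff (Suc N) (Suc k) = (1 + fps_X ^ (2 * N)) * zcoeff N (Suc k)
    - fps_X ^ N * (zcoeff N k + zcoeff N (Suc (Suc k)))"
proof -
  let ?X = "fps_X :: 'a fps"
  define y v where "y = ?X ^ N" and "v = ?X ^ k"
  define a b where "a = (qinv (int N - int k) :: 'a fps)" and "b = (qinv (int N + int k + 2) :: 'a fps)"
  have j: "int (N + k) = int N + int k" "int (Suc (N + k)) = int N + int k + 1"
    "int (Suc (Suc (N + k))) = int N + int k + 2" by simp_all
  have b1: "qinv (int N + int k + 1) = (1 - ?X ^ 2 * y * v) * b"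
    using qinv_of_nat[of "Suc (N + k)", where 'a = 'a] unfolding j
    by (simp add: b_def y_def v_def power_add mult_ac power2_eq_square)
  have b0: "qinv (int N + int k) = (1 - ?X * y * v) * (1 - ?X ^ 2 * y * v) * b"
    using qinv_of_nat[of "N + k", where 'a = 'a] unfolding j b1
    by (simp add: y_def v_def power_add mult_ac)
  have vv: "?X ^ Suc k = ?X * v" "?X ^ Suc (Suc k) = ?X^2 * v" by (simp_all add: v_def power2_eq_square)
  have c: "?X ^ (Suc k choose 2) = ?X ^ (k choose 2) * v"
    "?X ^ (Suc (Suc k) choose 2) = ?X ^ (k choose 2) * v * (?X * v)"
    by (simp_all add: choose_two_Suc power_add v_def mult_ac)
  define C where "C = (-1) ^ k * ?X ^ (k choose 2) * qfac (2 * N - 1)"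
  have i: "int (Suc N) - int (Suc k) = int N - int k" "int (Suc N) + int (Suc k) = int N + int k + 2"
    "int N - int (Suc k) = int N - int k - 1" "int N + int (Suc k) = int N + int k + 1"
    "int N - int (Suc (Suc k)) = int N - int k - 1 - 1" "int N + int (Suc (Suc k)) = int N + int k + 2" by simp_all
  have L: "zcoeff (Suc N) (Suc k) = - C * v * (1 + ?X * v) * (1 - y^2) * (1 - ?X * y^2) *
      (1 - ?X * y) * a * b"
    unfolding zcoeff_def qfac_double_step[OF assms] i C_def c vv
    by (simp add: y_def a_def b_def)
  have R1: "zcoeff N (Suc k) = - C * v * (1 + ?X * v) * (1 - y) * qinv (int N - int k - 1) *
       ((1 - ?X ^ 2 * y * v) * b)"
    unfolding zcoeff_def i C_def c vv b1 y_def by simp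
  have R0: "zcoeff N k = C * (1 + v) * (1 - y) * a * ((1 - ?X * y * v) * (1 - ?X ^ 2 * y * v) * b)"
    unfolding zcoeff_def C_def b0 y_def v_def a_def by (simp add: mult_ac)
  have R2: "zcoeff N (Suc (Suc k)) = C * v * (?X * v) * (1 + ?X ^2 * v) * (1 - y) *
     qinv (int N - int k - 1 - 1) * b"
    unfolding zcoeff_def i C_def c vv b_def y_def by (simp add: mult_ac)
  have y2: "?X ^ (2 * N) = y ^ 2" by (simp add: y_def mult.commute flip: power_mult)
  \<comment> \<open>For N < k all terms are 0; for N = k only \<open>zcoeff (Suc N) (Suc k)\<close>
    and \<open>zcoeff N k\<close> survive; only for N > k is q^(N-k-1) a power of q.\<close>
  consider "N < k" | "N = k" | d where "N = Suc (k + d)"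
    by (metis less_imp_Suc_add linorder_neqE_nat)
  thus ?thesis
  proof cases
    case 1
    thus ?thesis unfolding L R1 R0 R2 by (simp add: a_def qinv_neg)
  next
    case 2
    hence "v = y" by (simp add: v_def y_def)
    with 2 show ?thesis unfolding L R1 R0 R2 y2 y_def[symmetric]
      by (simp add: qinv_neg algebra_simps power2_eq_square)
  next
    case (3 d)
    define w where "w = ?X ^ d"
    have y: "y = ?X * v * w" by (simp add: y_def v_def w_def 3 power_add)
    have a1: "qinv (int N - int k - 1) = (1 - ?X * w) * a"
      using qinv_pred[of "int N - int k", where 'a = 'a] by (simp add: a_def 3 w_def nat_add_distrib)
    have a2: "qinv (int N - int k - 1 - 1) = (1 - w) * ((1 - ?X * w) * a)"
      using qinv_pred[of "int N - int k - 1", where 'a = 'a] unfolding a1 by (simp add: 3 w_def)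
    show ?thesis unfolding L R1 R0 R2 y2 y_def[symmetric] a1 a2 unfolding y
      by (simp add: algebra_simps power2_eq_square)
  qed
qed

text \<open>The constant coefficient of the same product: z and 1/z contribute equally, hence the
  factor 2.\<close>

lemma zcoeff_step_0:
  assumes "N > 0"
  shows "zcoeff (Suc N) 0 = (1 + fps_X ^ (2 * N)) * zcoeff N 0 - 2 * fps_X ^ N * zcoeff N 1"
proof -
  let ?X = "fps_X :: 'a fps"
  define y where "y = ?X ^ N"
  define b where "b = (qinv (int (Suc N)) :: 'a fps)"
  have b1: "qinv (int N) = (1 - ?X * y) * b"
    using qinv_of_nat[of N, where 'a = 'a] by (simp add: b_def y_def)
  have b0: "qinv (int N - 1) = (1 - y) * ((1 - ?X * y) * b)"
    using qinv_pred[of "int N", where 'a = 'a] b1 by (simp add: y_def)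
  have y2: "?X ^ (2 * N) = y ^ 2" by (simp add: y_def mult.commute flip: power_mult)
  define C where "C = qfac (2 * N - 1) * (1 - y) * (1 - ?X * y) * b * b"
  have "zcoeff (Suc N) 0 = C * 2 * (1 + y) * (1 - ?X * y ^ 2)"
    unfolding zcoeff_def qfac_double_step[OF assms] C_def b_def
    by (simp add: y_def numeral_2_eq_2 algebra_simps)
  moreover have "zcoeff N 0 = C * 2 * (1 - ?X * y)"
    unfolding zcoeff_def C_def by (simp add: b1 y_def numeral_2_eq_2)
  moreover have "zcoeff N 1 = - C * (1 + ?X) * (1 - y)"
  proof -
    have i: "int N - int 1 = int N - 1" "int N + int 1 = int (Suc N)" by simp_all
    show ?thesis
      unfolding zcoeff_def C_def i b0 b_def[symmetric] y_def[symmetric]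
      by (simp add: numeral_2_eq_2 algebra_simps)
  qed
  ultimately have z: "zcoeff (Suc N) 0 = C * 2 * (1 + y) * (1 - ?X * y ^ 2)"
    "zcoeff N 0 = C * 2 * (1 - ?X * y)" "zcoeff N 1 = - C * (1 + ?X) * (1 - y)" .
  show ?thesis
    unfolding z y2 y_def[symmetric] by (simp add: algebra_simps power2_eq_square)
qed

lemma zcoeff_beyond: "N < k \<Longrightarrow> zcoeff N k = 0"
  by (simp add: zcoeff_def qinv_neg)


lemma zcoeff_1: "zcoeff 1 0 = (2 :: 'a::comm_ring_1 fps)" "zcoeff 1 1 = (-1 :: 'a fps)"
proof -
  have f: "qfac (Suc 0) = 1 - (fps_X :: 'a fps)" "qfac 2 = (1 - fps_X) * (1 - (fps_X :: 'a fps) ^ 2)"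
    by (simp_all add: qfac_def numeral_2_eq_2)
  have i1: "(1 - fps_X) * qinv 1 = (1 :: 'a fps)"
    using qfac_qinv[of 1, where 'a = 'a] by (simp add: f)
  have i2: "(1 - fps_X) * (1 - fps_X ^ 2) * qinv 2 = (1 :: 'a fps)"
    using qfac_qinv[of 2, where 'a = 'a] by (simp add: f)
  have "zcoeff 1 0 = 2 * ((1 - fps_X) * qinv 1) * ((1 - fps_X) * qinv 1 :: 'a fps)"
    by (simp add: zcoeff_def f numeral_2_eq_2 algebra_simps)
  thus "zcoeff 1 0 = (2 :: 'a fps)" by (simp add: i1)
  have "qinv 0 = (1 :: 'a fps)"
    using qfac_qinv[of 0, where 'a = 'a] by (simp add: qfac_def)
  hence "zcoeff 1 1 = - ((1 - fps_X) * (1 - fps_X ^ 2) * qinv 2 :: 'a fps)"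
    by (simp add: zcoeff_def f numeral_2_eq_2 algebra_simps)
  thus "zcoeff 1 1 = (-1 :: 'a fps)" by (simp only: i2)
qed

text \<open>The hypotheses hold for z^k + z^-k, the doubled Chebyshev polynomials in z + 1/z:
  multiplication by \<open>s 1\<close> shifts indices both ways. The value \<open>s 0\<close> = 2
  yields \<open>2 * e 1\<close>; the two subtracted terms remove the coefficients with index above
  M, which the left-hand side does not contain.\<close>

lemma chebyshev_sum_mult:
  fixes s e :: "nat \<Rightarrow> 'a::comm_ring_1"
  assumes "s 0 = 2" and "\<And>k. s 1 * s (Suc k) = s (Suc (Suc k)) + s k"
  shows "s 1 * (e 0 + (\<Sum>k<M. e (Suc k) * s (Suc k))) =
    2 * e 1 + (\<Sum>k<Suc M. (e k + e (Suc (Suc k))) * s (Suc k))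
      - e (Suc M) * s M - e (Suc (Suc M)) * s (Suc M)"
proof (induction M)
  case 0
  show ?case by (simp add: assms(1) algebra_simps)
next
  case (Suc M)
  have "s 1 * (e 0 + (\<Sum>k<Suc M. e (Suc k) * s (Suc k))) =
    s 1 * (e 0 + (\<Sum>k<M. e (Suc k) * s (Suc k))) + e (Suc M) * (s 1 * s (Suc M))"
    by (simp add: algebra_simps)
  thus ?case
    unfolding Suc.IH assms(2) by (simp add: algebra_simps)
qed

text \<open>Induction on N with the two recurrences for \<open>zcoeff\<close>. \<open>Z\<close> is
  an arbitrary homomorphism from the integers, so that both \<open>zpow\<close> and the
  specialisation z = 1 are covered.\<close>

lemma finite_triple_product:
  fixes Z :: "int \<Rightarrow> 'a::comm_ring_1 fps"
  assumes Z: "Z 0 = 1" "\<And>a b. Z (a + b) = Z a * Z b" and N: "N > 0"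
  shows "(\<Prod>i<N. (1 - Z 1 * fps_X ^ i) * (1 - Z (-1) * fps_X ^ i)) =
    zcoeff N 0 + (\<Sum>k<N. zcoeff N (Suc k) * (Z (int (Suc k)) + Z (- int (Suc k))))"
proof -
  define s where "s k = Z (int k) + Z (- int k)" for k
  have s0: "s 0 = 2" by (simp add: s_def Z(1))
  have s1: "s 1 * s (Suc k) = s (Suc (Suc k)) + s k" for k
    unfolding s_def distrib_left distrib_right Z(2)[symmetric] by (simp add: add_ac)
  have inv: "Z 1 * Z (-1) = 1" using Z(2)[of 1 "-1"] Z(1) by simp
  show ?thesis
    unfolding s_def[symmetric] using N
  proof (induction N rule: nat_induct_non_zero)
    case 1
    show ?case
      using inv by (simp add: zcoeff_1[simplified] algebra_simps) (simp add: s_def)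
  next
    case (Suc N)
    define y where "y = (fps_X :: 'a fps) ^ N"
    have y2: "(fps_X :: 'a fps) ^ (2 * N) = y ^ 2"
      by (simp add: y_def power_even_eq)
    have f: "(1 - Z 1 * y) * (1 - Z (-1) * y) = 1 + y ^ 2 - y * s 1"
    proof -
      have "(1 - Z 1 * y) * (1 - Z (-1) * y) = 1 + (Z 1 * Z (-1)) * y ^ 2 - y * (Z 1 + Z (-1))"
        by (simp add: algebra_simps power2_eq_square)
      thus ?thesis by (simp add: inv s_def)
    qed
    let ?S = "zcoeff N 0 + (\<Sum>k<N. zcoeff N (Suc k) * s (Suc k))"
    let ?E = "\<Sum>k<Suc N. zcoeff N (Suc k) * s (Suc k)"
    let ?T = "\<Sum>k<Suc N. (zcoeff N k + zcoeff N (Suc (Suc k))) * s (Suc k)"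
    \<comment> \<open>The added summand k = N is 0; now all sums have the range of the sum for
      \<open>Suc N\<close>.\<close>
    have S: "?S = zcoeff N 0 + ?E" by (simp add: zcoeff_beyond)
    have "s 1 * ?S = 2 * zcoeff N 1 + ?T"
      by (subst chebyshev_sum_mult[OF s0 s1]) (simp add: zcoeff_beyond)
    hence "(1 + y ^ 2 - y * s 1) * ?S =
      (1 + y ^ 2) * zcoeff N 0 - 2 * y * zcoeff N 1 + ((1 + y ^ 2) * ?E - y * ?T)"
      unfolding left_diff_distrib mult.assoc S by (simp add: algebra_simps)
    also have "(1 + y ^ 2) * ?E - y * ?T = (\<Sum>k<Suc N. zcoeff (Suc N) (Suc k) * s (Suc k))"
      unfolding zcoeff_step_Suc[OF \<open>N > 0\<close>] y2 y_def[symmetric] sum_distrib_left sum_subtractf[symmetric]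
      by (intro sum.cong refl) (simp add: algebra_simps)
    also have "(1 + y ^ 2) * zcoeff N 0 - 2 * y * zcoeff N 1 = zcoeff (Suc N) 0"
      unfolding zcoeff_step_0[OF \<open>N > 0\<close>] y2 y_def ..
    finally show ?case
      unfolding prod.lessThan_Suc Suc.IH y_def[symmetric] f by (simp only: mult.commute)
  qed
qed

section \<open>Specialisation to the Laurent variable z\<close>

lemma zpow_add: "zpow (a + b) = zpow a * zpow b"
  by (simp add: zpow_def Poly_Mapping.mult_single)

lemma zpow_0: "zpow 0 = 1"
  by (simp add: zpow_def)

definition zdiff :: "nat \<Rightarrow> laurent fps" where
  "zdiff k = zpow (int k) + zpow (- int k) - 2"

text \<open>At z = 1 the factor i = 0 makes the product vanish, so the constant coefficient is minus
  twice the sum of the other ones and can be absorbed into them.\<close>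

lemma prod_zpow_expansion:
  assumes "N > 0"
  shows "(\<Prod>i<N. (1 - zpow 1 * q ^ i) * (1 - zpow (-1) * q ^ i)) =
    (\<Sum>k<N. zcoeff N (Suc k) * zdiff (Suc k))"
proof -
  have "(0 :: laurent fps) = (\<Prod>i<N. (1 - 1 * q ^ i) * (1 - 1 * q ^ i))"
    using assms by (auto simp: prod_zero_iff intro!: bexI[of _ 0])
  also have "\<dots> = zcoeff N 0 + (\<Sum>k<N. zcoeff N (Suc k) * 2)"
    using finite_triple_product[of "\<lambda>_. 1 :: laurent fps" N] assms by simp
  finally have "zcoeff N 0 = - (\<Sum>k<N. zcoeff N (Suc k) * (2 :: laurent fps))"
    by (simp add: eq_neg_iff_add_eq_0)
  thus ?thesis
    using finite_triple_product[OF zpow_0 zpow_add assms]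
    by (simp add: zdiff_def algebra_simps sum_subtractf sum.distrib)
qed


subsection \<open>Congruences modulo powers of the variable\<close>

text \<open>Identities between infinite sums are proved by truncating both sides modulo q^m for
  every m, see \<open>fps_eqI_cong\<close>.\<close>

definition fps_cong :: "nat \<Rightarrow> 'a::comm_ring_1 fps \<Rightarrow> 'a fps \<Rightarrow> bool" where
  "fps_cong m f g \<longleftrightarrow> fps_X ^ m dvd f - g"

lemma fps_cong_iff_nth: "fps_cong m f g \<longleftrightarrow> (\<forall>i<m. f $ i = g $ i)"
proof
  assume "fps_cong m f g"
  then obtain h where h: "f - g = fps_X ^ m * h"
    by (auto simp: fps_cong_def)
  have "(f - g) $ i = 0" if "i < m" for i
    using that by (simp add: h fps_X_power_mult_nth)
  thus "\<forall>i<m. f $ i = g $ i"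
    by simp
next
  assume *: "\<forall>i<m. f $ i = g $ i"
  have "f - g = fps_X ^ m * Abs_fps (\<lambda>i. (f - g) $ (i + m))"
    using * by (intro fps_ext) (simp add: fps_X_power_mult_nth)
  thus "fps_cong m f g"
    unfolding fps_cong_def by (rule dvdI)
qed

lemma fps_eqI_cong: "(\<And>m. fps_cong m f g) \<Longrightarrow> f = g"
  by (intro fps_ext) (auto simp: fps_cong_iff_nth)

lemma fps_cong_refl [simp]: "fps_cong m f f"
  by (simp add: fps_cong_iff_nth)

lemma fps_cong_sym: "fps_cong m f g \<Longrightarrow> fps_cong m g f"
  by (simp add: fps_cong_iff_nth)

lemma fps_cong_trans [trans]: "fps_cong m f g \<Longrightarrow> fps_cong m g h \<Longrightarrow> fps_cong m f h"
  by (simp add: fps_cong_iff_nth)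

lemma fps_cong_mono: "fps_cong m f g \<Longrightarrow> n \<le> m \<Longrightarrow> fps_cong n f g"
  by (simp add: fps_cong_iff_nth)

lemma fps_cong_add: "fps_cong m f g \<Longrightarrow> fps_cong m f' g' \<Longrightarrow> fps_cong m (f + f') (g + g')"
  by (simp add: fps_cong_iff_nth)

lemma fps_cong_mult:
  assumes "fps_cong m f g" "fps_cong m f' g'"
  shows "fps_cong m (f * f') (g * g')"
  using assms by (auto simp: fps_cong_iff_nth fps_mult_nth intro!: sum.cong)

lemma fps_cong_sum: "(\<And>i. i \<in> A \<Longrightarrow> fps_cong m (f i) (g i)) \<Longrightarrow> fps_cong m (sum f A) (sum g A)"
  by (simp add: fps_cong_iff_nth fps_sum_nth)

lemma fps_cong_X_power_mult:
  "fps_cong m f g \<Longrightarrow> fps_cong (n + m) (fps_X ^ n * f) (fps_X ^ n * g)"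
  by (auto simp: fps_cong_iff_nth fps_X_power_mult_nth)

lemma fps_cong_X_power_0: "n \<le> m \<Longrightarrow> fps_cong n (fps_X ^ m * f) 0"
  by (simp add: fps_cong_iff_nth fps_X_power_mult_nth)

text \<open>Summands with index above \<open>B e\<close> do not reach the coefficient of q^e, so the
  first n summands settle all coefficients below q^d.\<close>

lemma suminf_cong_partial:
  fixes f :: "nat \<Rightarrow> laurent fps"
  assumes f: "\<And>n e. B e < n \<Longrightarrow> f n $ e = 0"
    and B: "\<And>e. e < d \<Longrightarrow> B e < n"
  shows "fps_cong d (suminf f) (sum f {..<n})"
  unfolding fps_cong_iff_nth
proof (intro allI impI)
  fix e assume e: "e < d"
  have "f sums suminf f"
    using f by (intro summable_sums fps_summable)
  hence "\<forall>\<^sub>F N in sequentially. sum f {..<N} $ e = suminf f $ e"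
    by (simp add: sums_def tendsto_fps_iff)
  then obtain N where N: "\<And>M. M \<ge> N \<Longrightarrow> sum f {..<M} $ e = suminf f $ e"
    by (auto simp: eventually_sequentially)
  have "suminf f $ e = sum f {..<max N n} $ e"
    using N by simp
  also have "\<dots> = sum f {..<n} $ e"
    unfolding fps_sum_nth
    by (rule sum.mono_neutral_right) (use f[of e] B[OF e] in auto)
  finally show "suminf f $ e = sum f {..<n} $ e" .
qed

subsection \<open>Infinite q-Pochhammer symbols\<close>

text \<open>\<open>has_prod\<close> also admits the value 0 caused by a zero factor; the nonzero
  constant coefficient excludes this case and leaves convergence of the partial products.\<close>

lemma qpoch_inf_LIMSEQ:
  assumes "a $ 0 \<noteq> 1"
  shows "(\<lambda>n. \<Prod>i\<le>n. 1 - a * q ^ i) \<longlonglongrightarrow> qpoch_inf a"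
proof -
  have "qpoch_inf a \<noteq> 0"
    using qpoch_inf_aux(2)[OF assms] assms by auto
  thus ?thesis
    using qpoch_inf_aux(1)[OF assms] by (auto simp: has_prod_def raw_has_prod_def)
qed

lemma qpoch_inf_step:
  assumes "a $ 0 \<noteq> 1"
  shows "qpoch_inf a = (1 - a) * qpoch_inf (a * q)"
proof (rule LIMSEQ_unique)
  let ?P = "\<lambda>a n. \<Prod>i\<le>n. 1 - a * q ^ i"
  show "(\<lambda>n. ?P a (Suc n)) \<longlonglongrightarrow> qpoch_inf a"
    by (rule LIMSEQ_Suc[OF qpoch_inf_LIMSEQ[OF assms]])
  have eq: "?P a (Suc n) = (1 - a) * ?P (a * q) n" for n
    by (subst prod.atMost_Suc_shift) (simp add: mult.assoc)
  have "?P (a * q) \<longlonglongrightarrow> qpoch_inf (a * q)"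
    by (rule qpoch_inf_LIMSEQ) simp
  hence *: "\<forall>\<^sub>F n in sequentially. ?P (a * q) n $ k = qpoch_inf (a * q) $ k" for k
    by (simp add: tendsto_fps_iff)
  \<comment> \<open>Only finitely many coefficients of the factors enter a given coefficient of a
    product, so multiplication by 1 - a preserves the limit.\<close>
  have **: "\<forall>\<^sub>F n in sequentially.
      \<forall>i\<in>{0..k}. ?P (a * q) n $ (k - i) = qpoch_inf (a * q) $ (k - i)" for k
    by (rule eventually_ball_finite) (use * in auto)
  have "\<forall>\<^sub>F n in sequentially.
      ((1 - a) * ?P (a * q) n) $ k = ((1 - a) * qpoch_inf (a * q)) $ k" for k
    unfolding fps_mult_nth by (rule eventually_mono[OF **[of k]]) simp
  thus "(\<lambda>n. ?P a (Suc n)) \<longlonglongrightarrow> (1 - a) * qpoch_inf (a * q)"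
    unfolding eq tendsto_fps_iff by blast
qed

lemma qpoch_inf_split:
  assumes "a $ 0 \<noteq> 1"
  shows "qpoch_inf a = (\<Prod>i<n. 1 - a * q ^ i) * qpoch_inf (a * q ^ n)"
proof (induction n)
  case (Suc n)
  have "(a * q ^ n) $ 0 \<noteq> 1"
    using assms by (cases n) auto
  from qpoch_inf_step[OF this] Suc show ?case
    by (simp add: mult_ac)
qed simp

lemma qpoch_inf_cong_1:
  assumes "a $ 0 \<noteq> 1" "q ^ m dvd a"
  shows "fps_cong m (qpoch_inf a) 1"
proof -
  have P: "fps_cong m (\<Prod>i<n. 1 - a * q ^ i) 1" for n
  proof (induction n)
    case (Suc n)
    have "fps_cong m (1 - a * q ^ n) 1"
      using assms(2) by (simp add: fps_cong_def)
    from fps_cong_mult[OF Suc this] show ?case by simp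
  qed simp
  show ?thesis
    unfolding fps_cong_iff_nth
  proof (intro allI impI)
    fix i assume "i < m"
    have "\<forall>\<^sub>F n in sequentially. (\<Prod>i\<le>n. 1 - a * q ^ i) $ i = qpoch_inf a $ i"
      using qpoch_inf_LIMSEQ[OF assms(1)] by (simp add: tendsto_fps_iff)
    then obtain n where "(\<Prod>i\<le>n. 1 - a * q ^ i) $ i = qpoch_inf a $ i"
      by (auto simp: eventually_sequentially)
    with P[of "Suc n"] \<open>i < m\<close> show "qpoch_inf a $ i = 1 $ i"
      by (simp add: fps_cong_iff_nth lessThan_Suc_atMost)
  qed
qed

lemma qpoch_inf_q_split: "qpoch_inf q = qfac n * qpoch_inf (q ^ Suc n)"
proof -
  have "(\<Prod>i<n. 1 - q * q ^ i) = qfac n"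
    by (simp add: qfac_def prod.atLeast1_atMost_eq)
  thus ?thesis
    using qpoch_inf_split[of q n] by simp
qed

lemma qpoch_inf_q_qinv: "qpoch_inf q * qinv (int n) = qpoch_inf (q ^ Suc n)"
  by (subst qpoch_inf_q_split[of n]) (metis mult.assoc mult.commute mult_1 qfac_qinv)

lemma qpoch_inf_q_qinv_cong: "m \<le> n \<Longrightarrow> fps_cong m (qpoch_inf q * qinv (int n)) 1"
  unfolding qpoch_inf_q_qinv
  by (rule fps_cong_mono[OF qpoch_inf_cong_1[of _ "Suc n"]]) auto

text \<open>Modulo q^m, both (q)_a and (q)_b agree with (q)_oo.\<close>

lemma qfac_qinv_cong:
  assumes "m \<le> a" "m \<le> b"
  shows "fps_cong m (qfac a * qinv (int b) :: laurent fps) 1"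
proof -
  have "fps_cong m (qpoch_inf (q ^ Suc a)) 1"
    by (rule fps_cong_mono[OF qpoch_inf_cong_1[of _ "Suc a"]]) (use assms in auto)
  from fps_cong_mult[OF fps_cong_refl this, of "qfac a"]
  have "fps_cong m (qfac a) (qpoch_inf q)"
    by (simp add: fps_cong_sym del: power_Suc flip: qpoch_inf_q_split)
  from fps_cong_mult[OF this fps_cong_refl] qpoch_inf_q_qinv_cong[OF assms(2)]
  show ?thesis by (rule fps_cong_trans)
qed

subsection \<open>Creative telescoping\<close>

text \<open>Up to the factor (-1)^k q^(k choose 2) (1 + q^k), this is \<open>zcoeff N k\<close>
  divided by (q)_N; the factor 1 - q^N of \<open>zcoeff\<close> turns 1/(q)_N into
  1/(q)_(N-1).\<close>

definition coeff_summand :: "nat \<Rightarrow> nat \<Rightarrow> 'a::comm_ring_1 fps" where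
  "coeff_summand k N = qfac (2 * N - 1) * qinv (int N - 1) * qinv (int N - int k) * qinv (int N + int k)"

text \<open>
  The solution of the q-Gosper equation behind \<open>coeff_summand_telescope\<close>; its polynomial unknown
  happens to be constant in \<open>N\<close>, namely \<open>1 - q\<^sup>2\<^sup>k\<^sup>+\<^sup>2\<close>.
\<close>

definition coeff_antidiff :: "nat \<Rightarrow> nat \<Rightarrow> 'a::comm_ring_1 fps" where
  "coeff_antidiff k N = (1 - fps_X ^ (2 * k + 2)) * qfac (2 * N - 1) * qinv (int N - 1) *
     qinv (int N - int k - 1) * qinv (int N + int k + 1)"

text \<open>All terms are multiples of the same product \<open>A * C * D * E\<close>. What remains
  is a polynomial identity in q, x = q^k and Q = q^r.\<close>

lemma coeff_summand_telescope:
  assumes "k > 0"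
  shows "fps_X ^ r * ((1 + fps_X ^ k) * coeff_summand k (k + r) -
      fps_X ^ (3 * k + 2) * (1 + fps_X ^ (k + 2)) * coeff_summand (k + 2) (k + r)) =
    coeff_antidiff k (Suc (k + r)) - coeff_antidiff k (k + r)"
proof -
  let ?X = "fps_X :: 'a fps"
  define x Q where "x = ?X ^ k" and "Q = ?X ^ r"
  define C D E where "C = (qinv (int (k + r)) :: 'a fps)" and "D = (qinv (int r) :: 'a fps)"
    and "E = (qinv (int (2 * k + r + 2)) :: 'a fps)"
  define A where "A = (qfac (2 * (k + r) - 1) :: 'a fps)"
  have C1: "qinv (int (k + r) - 1) = (1 - x * Q) * C"
    using qinv_pred[of "int (k + r)", where 'a = 'a] unfolding nat_int
    by (simp add: C_def x_def Q_def power_add)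
  have D1: "qinv (int r - 1) = (1 - Q) * D"
    using qinv_pred[of "int r", where 'a = 'a] unfolding nat_int
    by (simp add: D_def Q_def)
  have XX: "?X ^ (2 * k + r) = x ^ 2 * Q"
    by (simp add: x_def Q_def power_add mult.commute flip: power_mult)
  have E1: "qinv (int (2 * k + r + 1)) = (1 - ?X ^ 2 * x ^ 2 * Q) * E"
  proof -
    have "Suc (2 * k + r + 1) = 2 * k + r + 2"
      by simp
    moreover have "?X ^ (2 * k + r + 2) = ?X ^ 2 * x ^ 2 * Q"
      unfolding power_add[of _ "2 * k + r" 2] XX by (simp only: mult_ac)
    ultimately show ?thesis
      using qinv_of_nat[of "2 * k + r + 1", where 'a = 'a] by (simp only: E_def)
  qed
  have E0: "qinv (int (2 * k + r)) = (1 - ?X * x ^ 2 * Q) * ((1 - ?X ^ 2 * x ^ 2 * Q) * E)"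
    using qinv_of_nat[of "2 * k + r", where 'a = 'a, unfolded power_Suc XX, unfolded Suc_eq_plus1 E1]
    by (simp only: mult_ac)
  \<comment> \<open>The quotient (q)_r / (q)_(r-2) contains q^(r-1), which is no power of q for r =
    0. The factor q^2 clears it: q^2 (1 - q^(r-1)) = q (q - Q). For r = 0 both sides vanish.\<close>
  have D2: "Q * (x ^ 3 * ?X ^ 2) * qinv (int r - 2) = x ^ 3 * ?X * (?X - Q) * Q * ((1 - Q) * D)"
  proof (cases r)
    case 0
    thus ?thesis by (simp add: qinv_neg Q_def)
  next
    case (Suc s)
    have r2: "qinv (int r - 2) = (1 - ?X ^ s) * ((1 - Q) * D)"
      using qinv_pred[of "int s", where 'a = 'a] unfolding nat_int D1[symmetric] by (simp add: Suc)
    show ?thesis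
      unfolding r2 by (simp add: Suc Q_def algebra_simps power2_eq_square)
  qed
  have i: "int (k + r) - int k = int r" "int (k + r) + int k = int (2 * k + r)"
    "int (k + r) - int (k + 2) = int r - 2" "int (k + r) + int (k + 2) = int (2 * k + r + 2)"
    "int (2 * k + r) + 1 = int (2 * k + r + 1)"
    "int (Suc (k + r)) - 1 = int (k + r)" "int (Suc (k + r)) - int k - 1 = int r"
    "int (Suc (k + r)) + int k + 1 = int (2 * k + r + 2)"
    by simp_all
  have X: "?X ^ (3 * k + 2) = x ^ 3 * ?X ^ 2" "?X ^ (k + 2) = x * ?X ^ 2"
    "?X ^ (2 * k + 2) = x ^ 2 * ?X ^ 2" "?X ^ (k + r) = x * Q"
    unfolding x_def Q_def by (simp_all only: power_add mult_ac flip: power_mult)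
  have b0: "coeff_summand k (k + r) = A * ((1 - x * Q) * C) * D *
      ((1 - ?X * x ^ 2 * Q) * ((1 - ?X ^ 2 * x ^ 2 * Q) * E))"
    unfolding coeff_summand_def i C1 E0 by (simp add: A_def D_def)
  have b2: "coeff_summand (k + 2) (k + r) = A * ((1 - x * Q) * C) * qinv (int r - 2) * E"
    unfolding coeff_summand_def i C1 by (simp add: A_def E_def)
  have t0: "coeff_antidiff k (k + r) = (1 - x ^ 2 * ?X ^ 2) * A * ((1 - x * Q) * C) *
      ((1 - Q) * D) * ((1 - ?X ^ 2 * x ^ 2 * Q) * E)"
    unfolding coeff_antidiff_def i C1 D1 E1 X by (simp add: A_def)
  have t1: "coeff_antidiff k (Suc (k + r)) = (1 - x ^ 2 * ?X ^ 2) *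
      (A * (1 - (x * Q) ^ 2) * (1 - ?X * (x * Q) ^ 2)) * C * D * E"
    using qfac_double_step[of "k + r", where 'a = 'a] assms
    unfolding coeff_antidiff_def i X by (simp add: A_def C_def D_def E_def)
  have "?X ^ r * ((1 + ?X ^ k) * coeff_summand k (k + r) -
      ?X ^ (3 * k + 2) * (1 + ?X ^ (k + 2)) * coeff_summand (k + 2) (k + r)) =
    Q * (1 + x) * coeff_summand k (k + r) -
      (1 + x * ?X ^ 2) * (A * ((1 - x * Q) * C)) * (Q * (x ^ 3 * ?X ^ 2) * qinv (int r - 2)) * E"
    unfolding b2 X Q_def[symmetric] x_def[symmetric] by (simp add: algebra_simps)
  also have "\<dots> = coeff_antidiff k (Suc (k + r)) - coeff_antidiff k (k + r)"
    unfolding D2 b0 t0 t1 by (simp add: algebra_simps power2_eq_square power3_eq_cube)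
  finally show ?thesis .
qed


text \<open>The upper boundary term of the telescoping sum. One factor (q)_oo goes to each of two
  reciprocals and \<open>qfac\<close> to the third; each of these products is 1 modulo q^R.\<close>

lemma coeff_antidiff_cong:
  "fps_cong R ((qpoch_inf q) ^ 2 * coeff_antidiff k (Suc (k + R))) (1 - q ^ (2 * k + 2))"
proof -
  have i: "int (Suc (k + R)) - 1 = int (k + R)" "int (Suc (k + R)) - int k - 1 = int R"
    "int (Suc (k + R)) + int k + 1 = int (2 * k + R + 2)" by simp_all
  have "(qpoch_inf q) ^ 2 * coeff_antidiff k (Suc (k + R)) = (1 - q ^ (2 * k + 2)) *
     (qfac (2 * Suc (k + R) - 1) * qinv (int (k + R)) *
      ((qpoch_inf q * qinv (int R)) * (qpoch_inf q * qinv (int (2 * k + R + 2)))))"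
    unfolding coeff_antidiff_def i by (simp only: power2_eq_square mult_ac)
  moreover have "fps_cong R \<dots> ((1 - q ^ (2 * k + 2)) * (1 * (1 * 1)))"
    by (intro fps_cong_mult fps_cong_refl qfac_qinv_cong qpoch_inf_q_qinv_cong) auto
  ultimately show ?thesis by simp
qed

section \<open>The recurrence in k and its solution by iteration\<close>

definition coeff_partial_sum :: "nat \<Rightarrow> nat \<Rightarrow> 'a::comm_ring_1 fps" where
  "coeff_partial_sum k R = (\<Sum>r<R. fps_X ^ r * coeff_summand k (k + r))"

text \<open>The series F_k, with N = k + r as the index of the summand of S.\<close>

definition zcoeff_gf :: "nat \<Rightarrow> laurent fps" where
  "zcoeff_gf k = (qpoch_inf q) ^ 2 * (1 + q ^ k) * suminf (\<lambda>r. q ^ r * coeff_summand k (k + r))"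

lemma zcoeff_gf_cong:
  "fps_cong R (zcoeff_gf k) ((qpoch_inf q) ^ 2 * (1 + q ^ k) * coeff_partial_sum k R)"
  unfolding zcoeff_gf_def coeff_partial_sum_def
  by (intro fps_cong_mult fps_cong_refl suminf_cong_partial[where B = id])
     (auto simp: fps_X_power_mult_nth)

text \<open>The telescoping relation summed over r < R + 2; its lower boundary term contains
  1/(q)_(-1) = 0. The summands for k + 2 vanish at r = 0 and r = 1, and the shift of r by 2 raises
  q^(3k+2) to q^(3k+4) and leaves the range r < R.\<close>

lemma coeff_partial_sum_rec:
  assumes "k > 0"
  shows "(1 + fps_X ^ k) * coeff_partial_sum k (R + 2) =
    fps_X ^ (3 * k + 4) * (1 + fps_X ^ (k + 2)) * coeff_partial_sum (k + 2) R +
    coeff_antidiff k (k + R + 2)"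
proof -
  have b0: "coeff_summand (k + 2) k = (0 :: 'a fps)" "coeff_summand (k + 2) (Suc k) = (0 :: 'a fps)"
    by (simp_all add: coeff_summand_def qinv_neg)
  have "(\<Sum>r<R + 2. fps_X ^ r * ((1 + fps_X ^ k) * coeff_summand k (k + r) -
      fps_X ^ (3 * k + 2) * (1 + fps_X ^ (k + 2)) * coeff_summand (k + 2) (k + r))) =
    (\<Sum>r<R + 2. coeff_antidiff k (k + Suc r) - coeff_antidiff k (k + r) :: 'a fps)"
    by (intro sum.cong refl) (simp only: coeff_summand_telescope[OF assms] add_Suc_right)
  also have "\<dots> = coeff_antidiff k (k + (R + 2)) - coeff_antidiff k (k + 0)"
    by (rule sum_lessThan_telescope)
  also have "coeff_antidiff k (k + 0) = (0 :: 'a fps)"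
    by (simp add: coeff_antidiff_def qinv_neg)
  finally have *: "coeff_antidiff k (k + R + 2) = (1 + fps_X ^ k) * coeff_partial_sum k (R + 2) -
      fps_X ^ (3 * k + 2) * (1 + fps_X ^ (k + 2)) *
      (\<Sum>r<R + 2. fps_X ^ r * coeff_summand (k + 2) (k + r) :: 'a fps)"
    unfolding coeff_partial_sum_def sum_distrib_left sum_subtractf[symmetric]
    by (simp add: algebra_simps)
  have "(\<Sum>r<R + 2. fps_X ^ r * coeff_summand (k + 2) (k + r) :: 'a fps) =
      (\<Sum>r<R. fps_X ^ Suc (Suc r) * coeff_summand (k + 2) (k + Suc (Suc r)))"
    using b0 by (simp add: sum.lessThan_Suc_shift del: sum.lessThan_Suc power_Suc)
  also have "\<dots> = fps_X ^ 2 * coeff_partial_sum (k + 2) R"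
    by (simp add: coeff_partial_sum_def sum_distrib_left power2_eq_square mult.assoc)
  finally show ?thesis
    using * by (simp add: algebra_simps power_add power2_eq_square numeral_eq_Suc)
qed

text \<open>The previous recurrence as R grows: the boundary term tends to 1 - q^(2k+2).\<close>

lemma zcoeff_gf_rec:
  assumes "k > 0"
  shows "zcoeff_gf k = 1 - q ^ (2 * k + 2) + q ^ (3 * k + 4) * zcoeff_gf (k + 2)"
proof (rule fps_eqI_cong)
  fix R
  let ?Q = "(qpoch_inf q) ^ 2"
  have "fps_cong R (zcoeff_gf k) (?Q * (1 + q ^ k) * coeff_partial_sum k (R + 2))"
    by (rule fps_cong_mono[OF zcoeff_gf_cong]) simp
  also have "?Q * (1 + q ^ k) * coeff_partial_sum k (R + 2) =
      ?Q * coeff_antidiff k (Suc (k + Suc R)) +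
      q ^ (3 * k + 4) * (?Q * (1 + q ^ (k + 2)) * coeff_partial_sum (k + 2) R)"
    unfolding mult.assoc coeff_partial_sum_rec[OF assms] by (simp add: algebra_simps)
  also have "fps_cong R \<dots> (1 - q ^ (2 * k + 2) + q ^ (3 * k + 4) * zcoeff_gf (k + 2))"
    by (intro fps_cong_add fps_cong_mult fps_cong_refl fps_cong_sym[OF zcoeff_gf_cong]
        fps_cong_mono[OF coeff_antidiff_cong, of R "Suc R"]) simp
  finally show "fps_cong R (zcoeff_gf k)
    (1 - q ^ (2 * k + 2) + q ^ (3 * k + 4) * zcoeff_gf (k + 2))" .
qed

text \<open>The power of q accumulated in J steps has exponent 3J^2 + J + 3Jk, the sum of 3(k + 2i)
  + 4 over i < J.\<close>

lemma zcoeff_gf_iter: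
  assumes "k > 0"
  shows "zcoeff_gf k = (\<Sum>j<J. q ^ (3 * j ^ 2 + j + 3 * j * k) * (1 - q ^ (4 * j + 2 + 2 * k))) +
    q ^ (3 * J ^ 2 + J + 3 * J * k) * zcoeff_gf (k + 2 * J)"
proof (induction J)
  case (Suc J)
  have e: "q ^ (3 * Suc J ^ 2 + Suc J + 3 * Suc J * k) =
    q ^ (3 * J ^ 2 + J + 3 * J * k) * q ^ (3 * (k + 2 * J) + 4)"
    unfolding power_add[symmetric]
    by (rule arg_cong[where f = "power _"]) (simp add: power2_eq_square algebra_simps)
  have r: "zcoeff_gf (k + 2 * J) = 1 - q ^ (4 * J + 2 + 2 * k) +
      q ^ (3 * (k + 2 * J) + 4) * zcoeff_gf (k + 2 * Suc J)"
    using zcoeff_gf_rec[of "k + 2 * J"] assms by (simp add: algebra_simps)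
  thus ?case
    unfolding Suc.IH e sum.lessThan_Suc r by (simp only: distrib_left add.assoc mult.assoc)
qed simp

lemma zcoeff_gf_theta_cong:
  assumes "k > 0"
  shows "fps_cong J (zcoeff_gf k)
    (\<Sum>j<J. q ^ (3 * j ^ 2 + j + 3 * j * k) * (1 - q ^ (4 * j + 2 + 2 * k)))"
  using fps_cong_add[OF fps_cong_refl fps_cong_X_power_0,
      of J "3 * J ^ 2 + J + 3 * J * k" _ "zcoeff_gf (k + 2 * J)"]
  by (subst zcoeff_gf_iter[OF assms, of J]) simp

section \<open>Expansion of the left-hand side\<close>

definition zweight :: "nat \<Rightarrow> laurent fps" where
  "zweight k = (-1) ^ k * q ^ (Suc k choose 2) * zdiff k"

text \<open>With N = n + 1, the denominator cancels all but (z)_N (1/z)_N, and the two remaining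
  symbols give (q)_oo^2 / (q)_N. In the term of z^(k+1), q^N splits into q^(k+1) q^(n-k); the first
  factor turns the exponent (k+1 choose 2) of \<open>zcoeff\<close> into the (k+2 choose 2) of
  \<open>zweight\<close>.\<close>

lemma product_spt_term:
  "qpoch_inf (zpow 1) * qpoch_inf (zpow (-1)) * qpoch_inf q * spt_term (Suc n) =
    (\<Sum>k\<le>n. zweight (Suc k) *
      ((qpoch_inf q) ^ 2 * (1 + q ^ Suc k) * (q ^ (n - k) * coeff_summand (Suc k) (Suc k + (n - k)))))"
proof -
  define N where "N = Suc n"
  hence "N > 0" by simp
  have z: "zpow j $ 0 \<noteq> 1" if "j \<noteq> 0" for j
  proof -
    have "Poly_Mapping.single j (1::int) \<noteq> 1"
      using that by (auto dest!: arg_cong[where f = "\<lambda>p. Poly_Mapping.lookup p j"]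
        simp: lookup_one when_def)
    thus ?thesis by (auto simp: zpow_def)
  qed
  define D where "D = qpoch_inf (zpow 1 * q ^ N) * qpoch_inf (zpow (-1) * q ^ N)"
  have D: "D * fps_right_inverse D 1 = 1"
    unfolding D_def by (rule spt_denominator) fact
  let ?P = "\<Prod>i<N. (1 - zpow 1 * q ^ i) * (1 - zpow (-1) * q ^ i)"
  have "qpoch_inf (zpow 1) * qpoch_inf (zpow (-1)) = ?P * D"
    unfolding qpoch_inf_split[OF z, of 1 N, simplified] qpoch_inf_split[OF z, of "-1" N, simplified]
    by (simp add: D_def prod.distrib mult_ac)
  hence "qpoch_inf (zpow 1) * qpoch_inf (zpow (-1)) * qpoch_inf q * spt_term N =
     (D * fps_right_inverse D 1) * (?P * qpoch_inf q * q ^ N * (qpoch_inf q * qinv (int N)))"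
    unfolding spt_term_def D_def[symmetric] qpoch_inf_q_qinv by (simp add: mult_ac)
  also have "\<dots> = (\<Sum>k<N. zcoeff N (Suc k) * zdiff (Suc k) * ((qpoch_inf q) ^ 2 * q ^ N * qinv (int N)))"
    unfolding D sum_distrib_right[symmetric] prod_zpow_expansion[OF \<open>N > 0\<close>, symmetric]
    by (simp add: power2_eq_square mult_ac)
  also have "\<dots> = (\<Sum>k<N. zweight (Suc k) *
      ((qpoch_inf q) ^ 2 * (1 + q ^ Suc k) * (q ^ (n - k) * coeff_summand (Suc k) (Suc k + (n - k)))))"
  proof (rule sum.cong[OF refl])
    fix k assume "k \<in> {..<N}"
    hence k: "Suc k + (n - k) = N" by (simp add: N_def)
    have "qinv (int N - 1) = (1 - q ^ N) * qinv (int N)"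
      using qinv_pred[of "int N"] unfolding nat_int .
    moreover have "q ^ (Suc (Suc k) choose 2) * q ^ (n - k) = q ^ (Suc k choose 2) * q ^ N"
      by (simp add: choose_two_Suc[of "Suc k"] k[symmetric] flip: power_add)
    ultimately show "zcoeff N (Suc k) * zdiff (Suc k) * ((qpoch_inf q) ^ 2 * q ^ N * qinv (int N)) =
      zweight (Suc k) * ((qpoch_inf q) ^ 2 * (1 + q ^ Suc k) *
        (q ^ (n - k) * coeff_summand (Suc k) (Suc k + (n - k))))"
      unfolding k zcoeff_def zweight_def coeff_summand_def
      by (simp del: power_Suc of_nat_Suc add: mult_ac)
  qed
  finally show ?thesis by (simp only: N_def lessThan_Suc_atMost)
qed

text \<open>The summations over n < d and k \<le> n are interchanged with r = n - k. The inner sum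
  for k then is the truncation of \<open>zcoeff_gf (Suc k)\<close> at r < d - k.\<close>

lemma product_spt_crank_gf_cong:
  "fps_cong d (qpoch_inf (zpow 1) * qpoch_inf (zpow (-1)) * qpoch_inf q * spt_crank_gf)
    (\<Sum>k<d. zweight (Suc k) * (\<Sum>j<d. q ^ (3 * j ^ 2 + j + 3 * j * Suc k) *
       (1 - q ^ (4 * j + 2 + 2 * Suc k))))"
proof -
  let ?C = "qpoch_inf (zpow 1) * qpoch_inf (zpow (-1)) * qpoch_inf q"
  let ?a = "\<lambda>k. (qpoch_inf q) ^ 2 * (1 + q ^ Suc k)"
  let ?b = "\<lambda>k r. zweight (Suc k) * (?a k * (q ^ r * coeff_summand (Suc k) (Suc k + r)))"
  have "fps_cong d (?C * spt_crank_gf) (?C * (\<Sum>n<d. spt_term (n + 1)))"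
    unfolding spt_crank_gf_def
    by (intro fps_cong_mult fps_cong_refl suminf_cong_partial[where B = id])
       (auto simp: spt_term_def mult.assoc fps_X_power_mult_nth simp del: power_Suc)
  also have "?C * (\<Sum>n<d. spt_term (n + 1)) = (\<Sum>n<d. \<Sum>k\<le>n. ?b k (n - k))"
    unfolding sum_distrib_left Suc_eq_plus1[symmetric] product_spt_term ..
  also have "\<dots> = (\<Sum>(k, r)\<in>{(k, r). k + r < d}. ?b k r)"
    by (rule sum.triangle_reindex[symmetric])
  also have "{(k, r). k + r < d} = Sigma {..<d} (\<lambda>k. {..<d - k})"
    by auto
  also have "(\<Sum>(k, r)\<in>Sigma {..<d} (\<lambda>k. {..<d - k}). ?b k r) = (\<Sum>k<d. \<Sum>r<d - k. ?b k r)"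
    by (rule sum.Sigma[symmetric]) auto
  also have "\<dots> = (\<Sum>k<d. zweight (Suc k) * (?a k * coeff_partial_sum (Suc k) (d - k)))"
    unfolding coeff_partial_sum_def sum_distrib_left ..
  also have "fps_cong d \<dots> (\<Sum>k<d. zweight (Suc k) * zcoeff_gf (Suc k))"
  proof (rule fps_cong_sum)
    fix k assume "k \<in> {..<d}"
    \<comment> \<open>The truncation is only correct modulo q^(d-k); the factor in front has
      exponent at least k and restores the precision d.\<close>
    have "fps_cong ((Suc (Suc k) choose 2) + (d - k))
        (q ^ (Suc (Suc k) choose 2) * (?a k * coeff_partial_sum (Suc k) (d - k)))
        (q ^ (Suc (Suc k) choose 2) * zcoeff_gf (Suc k))"
      by (intro fps_cong_X_power_mult fps_cong_sym[OF zcoeff_gf_cong])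
    hence "fps_cong d (q ^ (Suc (Suc k) choose 2) * (?a k * coeff_partial_sum (Suc k) (d - k)))
        (q ^ (Suc (Suc k) choose 2) * zcoeff_gf (Suc k))"
      by (rule fps_cong_mono) (simp add: choose_two_Suc)
    from fps_cong_mult[OF fps_cong_refl this, of "(-1) ^ Suc k * zdiff (Suc k)"]
    show "fps_cong d (zweight (Suc k) * (?a k * coeff_partial_sum (Suc k) (d - k)))
        (zweight (Suc k) * zcoeff_gf (Suc k))"
      unfolding zweight_def by (simp only: mult_ac)
  qed
  also have "fps_cong d \<dots> (\<Sum>k<d. zweight (Suc k) * (\<Sum>j<d. q ^ (3 * j ^ 2 + j + 3 * j * Suc k) *
       (1 - q ^ (4 * j + 2 + 2 * Suc k))))"
    by (intro fps_cong_sum fps_cong_mult fps_cong_refl zcoeff_gf_theta_cong) simp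
  finally show ?thesis .
qed


subsection \<open>The Hecke-type double sum\<close>

lemma zdiff_eq: "(1 - zpow (int k)) ^ 2 * zpow (- int k) = zdiff k"
proof -
  have "zpow (int k) * zpow (- int k) = 1"
    by (simp add: zpow_0 flip: zpow_add)
  hence "(1 - zpow (int k)) ^ 2 * zpow (- int k) = zpow (- int k) - 2 + zpow (int k)"
    by (simp add: algebra_simps power2_eq_square)
  thus ?thesis by (simp add: zdiff_def)
qed

text \<open>The second hypothesis says ((3n^2 - m^2)/2 - 1)/12 = e for n = m + 2k, free of division
  and subtraction.\<close>

lemma hecke_term_shift:
  assumes "kronecker_minus4 (m + 2 * k) * kronecker_12 m = c"
    and "3 * (m + 2 * k) ^ 2 = m ^ 2 + 2 * (12 * e + 1)"
  shows "hecke_term (m + 2 * k) m = zdiff k * of_int c * q ^ e"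
proof -
  have "(int (m + 2 * k) - int m) div 2 = int k" "(int m - int (m + 2 * k)) div 2 = - int k"
    by simp_all
  moreover have "((3 * (m + 2 * k) ^ 2 - m ^ 2) div 2 - 1) div 12 = e"
    unfolding assms(2) by simp
  ultimately show ?thesis
    unfolding hecke_term_def by (simp only: zdiff_eq mult.assoc assms(1)[symmetric] of_int_mult)
qed

text \<open>Both numbers n are 1 + 2(j + k) modulo 4, so the first symbol is (-1)^(j+k). The second
  is (-1)^j for m = 6j + 1 and -(-1)^j for m = 6j + 5. Hence only the parities of j and k
  matter.\<close>

lemma kronecker_product:
  "kronecker_minus4 (6 * j + 1 + 2 * k) * kronecker_12 (6 * j + 1) = (-1) ^ k"
  "kronecker_minus4 (6 * j + 5 + 2 * k) * kronecker_12 (6 * j + 5) = - ((-1) ^ k)"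
proof -
  define a b where "a = j div 2" and "b = k div 2"
  consider "j = 2 * a" "k = 2 * b" | "j = 2 * a" "k = 2 * b + 1"
    | "j = 2 * a + 1" "k = 2 * b" | "j = 2 * a + 1" "k = 2 * b + 1"
    by (metis a_def b_def even_two_times_div_two odd_two_times_div_two_succ)
  hence "kronecker_minus4 (6 * j + 1 + 2 * k) * kronecker_12 (6 * j + 1) = (-1) ^ k \<and>
    kronecker_minus4 (6 * j + 5 + 2 * k) * kronecker_12 (6 * j + 5) = - ((-1) ^ k)"
  proof cases
    case 1
    have "(6 * j + 1 + 2 * k) mod 4 = 1" "(6 * j + 5 + 2 * k) mod 4 = 1"
      "(6 * j + 1) mod 12 = 1" "(6 * j + 5) mod 12 = 5"
      unfolding 1 by presburger+
    thus ?thesis unfolding kronecker_minus4_def kronecker_12_def by (simp add: 1)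
  next
    case 2
    have "(6 * j + 1 + 2 * k) mod 4 = 3" "(6 * j + 5 + 2 * k) mod 4 = 3"
      "(6 * j + 1) mod 12 = 1" "(6 * j + 5) mod 12 = 5"
      unfolding 2 by presburger+
    thus ?thesis unfolding kronecker_minus4_def kronecker_12_def by (simp add: 2)
  next
    case 3
    have "(6 * j + 1 + 2 * k) mod 4 = 3" "(6 * j + 5 + 2 * k) mod 4 = 3"
      "(6 * j + 1) mod 12 = 7" "(6 * j + 5) mod 12 = 11"
      unfolding 3 by presburger+
    thus ?thesis unfolding kronecker_minus4_def kronecker_12_def by (simp add: 3)
  next
    case 4
    have "(6 * j + 1 + 2 * k) mod 4 = 1" "(6 * j + 5 + 2 * k) mod 4 = 1"
      "(6 * j + 1) mod 12 = 7" "(6 * j + 5) mod 12 = 11"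
      unfolding 4 by presburger+
    thus ?thesis unfolding kronecker_minus4_def kronecker_12_def by (simp add: 4)
  qed
  thus "kronecker_minus4 (6 * j + 1 + 2 * k) * kronecker_12 (6 * j + 1) = (-1) ^ k"
    "kronecker_minus4 (6 * j + 5 + 2 * k) * kronecker_12 (6 * j + 5) = - ((-1) ^ k)"
    by simp_all
qed

text \<open>For n = m + 2k the exponent is (m^2 + 6mk + 6k^2 - 1)/12. Passing from m = 6j + 1 to m =
  6j + 5 adds 4j + 2 + 2k to it and reverses the sign.\<close>

lemma hecke_term_pair:
  "hecke_term (6 * j + 1 + 2 * k) (6 * j + 1) + hecke_term (6 * j + 5 + 2 * k) (6 * j + 5) =
    zweight k * (q ^ (3 * j ^ 2 + j + 3 * j * k) * (1 - q ^ (4 * j + 2 + 2 * k)))"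
proof -
  define c where "c = Suc k choose 2"
  have c: "2 * c = k ^ 2 + k"
    unfolding c_def choose_two by (simp add: power2_eq_square)
  define e where "e = c + (3 * j ^ 2 + j + 3 * j * k)"
  have "hecke_term (6 * j + 1 + 2 * k) (6 * j + 1) = zdiff k * of_int ((-1) ^ k) * q ^ e"
    by (rule hecke_term_shift[OF kronecker_product(1)])
       (use c in \<open>simp add: e_def power2_eq_square algebra_simps\<close>)
  moreover have "hecke_term (6 * j + 5 + 2 * k) (6 * j + 5) =
      zdiff k * of_int (- ((-1) ^ k)) * q ^ (e + (4 * j + 2 + 2 * k))"
    by (rule hecke_term_shift[OF kronecker_product(2)])
       (use c in \<open>simp add: e_def power2_eq_square algebra_simps\<close>)
  ultimately show ?thesis
    unfolding zweight_def power_add[of q e] unfolding e_def c_def power_add[of q "Suc k choose 2"]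
    by (simp add: right_diff_distrib mult.assoc mult.left_commute del: binomial_Suc_Suc)
qed

section \<open>Reordering and truncation of the double sum\<close>

lemma hecke_term_eq_0:
  assumes "kronecker_minus4 n = 0 \<or> kronecker_12 m = 0"
  shows "hecke_term n m = 0"
  using assms by (auto simp: hecke_term_def)

lemma hecke_term_nth_eq_0:
  assumes "m \<le> n" "12 * e + 1 < n"
  shows "hecke_term n m $ e = 0"
proof (cases "kronecker_minus4 n = 0 \<or> kronecker_12 m = 0")
  case False
  hence "e < ((3 * n ^ 2 - m ^ 2) div 2 - 1) div 12"
    using hecke_exponents(4)[of n m] assms by linarith
  thus ?thesis
    unfolding hecke_term_def by (subst fps_X_power_mult_right_nth) simp
qed (simp add: hecke_term_eq_0)

lemma kronecker_12_nonzero_mod_6: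
  assumes "kronecker_12 m \<noteq> 0"
  shows "m mod 6 \<in> {1, 5}"
proof -
  have "m mod 12 \<in> {1, 5, 7, 11}"
    using assms by (auto simp: kronecker_12_def split: if_splits)
  moreover have "m mod 6 = m mod 12 mod 6"
    by (simp add: mod_mod_cancel)
  ultimately show ?thesis by auto
qed

text \<open>In each block of six consecutive m, only the residues 1 and 5 are coprime to 6;
  elsewhere the symbol modulo 12 vanishes.\<close>

lemma sum_hecke_term_residues:
  "(\<Sum>m<6 * B. hecke_term (m + 2 * k) m) =
    (\<Sum>j<B. hecke_term (6 * j + 1 + 2 * k) (6 * j + 1) + hecke_term (6 * j + 5 + 2 * k) (6 * j + 5))"
proof -
  let ?h = "\<lambda>m. hecke_term (m + 2 * k) m"
  have "(\<Sum>m<6 * B. ?h m) = (\<Sum>j<B. sum ?h {j * 6..<j * 6 + 6})"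
    unfolding sum.nat_group by (simp add: mult.commute)
  also have "\<dots> = (\<Sum>j<B. ?h (6 * j + 1) + ?h (6 * j + 5))"
  proof (rule sum.cong[OF refl])
    fix j
    have z: "?h (6 * j + i) = 0" if "i \<in> {0, 2, 3, 4}" for i
      using kronecker_12_nonzero_mod_6[of "6 * j + i"] that by (intro hecke_term_eq_0) auto
    have "sum ?h {j * 6..<j * 6 + 6} = (\<Sum>i\<in>{0, 1, 2, 3, 4, 5}. ?h (6 * j + i))"
      by (rule sum.reindex_bij_witness[of _ "\<lambda>i. 6 * j + i" "\<lambda>m. m - 6 * j"]) auto
    thus "sum ?h {j * 6..<j * 6 + 6} = ?h (6 * j + 1) + ?h (6 * j + 5)"
      using z[of 0] z[of 2] z[of 3] z[of 4] by (simp del: One_nat_def)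
  qed
  finally show ?thesis .
qed

text \<open>The triangle m \<le> n < B is exchanged for the pairs (m + 2(k+1), m) in a rectangle of
  k and m. The range of m is a multiple of 6 to match the blocks by residue. Pairs in only one of
  the regions contribute nothing below q^d.\<close>

lemma hecke_sum_cong:
  assumes "12 * d + 2 \<le> B"
  shows "fps_cong d (suminf (\<lambda>n. \<Sum>m=0..n. hecke_term n m))
    (\<Sum>k<B. \<Sum>m<6 * B. hecke_term (m + 2 * Suc k) m)"
proof -
  have "fps_cong d (suminf (\<lambda>n. \<Sum>m=0..n. hecke_term n m)) (\<Sum>n<B. \<Sum>m=0..n. hecke_term n m)"
    by (rule suminf_cong_partial[where B = "\<lambda>e. 12 * e + 1"])
       (use assms in \<open>auto simp: fps_sum_nth intro!: sum.neutral hecke_term_nth_eq_0\<close>)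
  also have "(\<Sum>n<B. \<Sum>m=0..n. hecke_term n m) =
      (\<Sum>(n, m)\<in>Sigma {..<B} (\<lambda>n. {0..n}). hecke_term n m)"
    by (rule sum.Sigma) auto
  also have "fps_cong d \<dots>
    (\<Sum>(n, m)\<in>(\<lambda>(k, m). (m + 2 * Suc k, m)) ` ({..<B} \<times> {..<6 * B}). hecke_term n m)"
    (is "fps_cong d (sum _ ?S) (sum _ ?T)")
    unfolding fps_cong_iff_nth fps_sum_nth
  proof (intro allI impI)
    fix e assume e: "e < d"
    show "(\<Sum>p\<in>?S. (case p of (n, m) \<Rightarrow> hecke_term n m) $ e) =
      (\<Sum>p\<in>?T. (case p of (n, m) \<Rightarrow> hecke_term n m) $ e)"
    proof (rule sum.mono_neutral_cong)
      show "finite ?T" "finite ?S" by auto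
    next
      fix p assume p: "p \<in> ?T - ?S"
      then obtain k m where p': "p = (m + 2 * Suc k, m)" by auto
      \<comment> \<open>Pairs outside the triangle have n \<ge> B > 12e + 1, so the order of their
        terms exceeds e.\<close>
      have "B \<le> m + 2 * Suc k"
      proof (rule ccontr)
        assume "\<not> B \<le> m + 2 * Suc k"
        hence "p \<in> ?S" unfolding p' by simp
        with p show False by blast
      qed
      with p'
      show "(case p of (n, m) \<Rightarrow> hecke_term n m) $ e = 0"
        using e assms by (auto intro!: hecke_term_nth_eq_0)
    next
      fix p assume p: "p \<in> ?S - ?T"
      then obtain n m where nm: "p = (n, m)" "n < B" "m \<le> n" by auto
      \<comment> \<open>Pairs in the triangle but not in the image have n = m, where 1 - z^0 is 0,
        or n - m odd, where one of n and m is even and its symbol vanishes.\<close>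
      have "hecke_term n m = 0"
      proof (cases "n = m")
        case True
        thus ?thesis by (simp add: hecke_term_def zpow_0)
      next
        case False
        have "odd (n - m)"
        proof
          assume "even (n - m)"
          then obtain k where k: "n - m = 2 * k" by (elim evenE)
          with nm False obtain l where "k = Suc l" by (cases k) auto
          with k nm False have "p = (\<lambda>(k, m). (m + 2 * Suc k, m)) (l, m)" "l < B" "m < 6 * B" by auto
          with p show False by blast
        qed
        hence "odd n \<longleftrightarrow> even m"
          using nm by simp
        hence "even n \<or> even m" by blast
        hence "kronecker_minus4 n = 0 \<or> kronecker_12 m = 0"
        proof
          assume "even n"
          hence "n mod 4 \<noteq> 1 \<and> n mod 4 \<noteq> 3" by presburger
          thus ?thesis by (simp add: kronecker_minus4_def)
        next
          assume "even m"
          hence "m mod 12 \<notin> {1, 5, 7, 11}" by (simp, presburger)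
          thus ?thesis by (simp add: kronecker_12_def)
        qed
        thus ?thesis by (rule hecke_term_eq_0)
      qed
      thus "(case p of (n, m) \<Rightarrow> hecke_term n m) $ e = 0" by (simp add: nm)
    qed auto
  qed
  also have "sum (\<lambda>(n, m). hecke_term n m) ?T =
      (\<Sum>(k, m)\<in>{..<B} \<times> {..<6 * B}. hecke_term (m + 2 * Suc k) m)"
    by (subst sum.reindex) (auto simp: inj_on_def case_prod_unfold intro!: sum.cong)
  also have "\<dots> = (\<Sum>k<B. \<Sum>m<6 * B. hecke_term (m + 2 * Suc k) m)"
    by (rule sum.cartesian_product[symmetric])
  finally show ?thesis .
qed

theorem theorem2p1:
  shows "qpoch_inf (zpow 1) * qpoch_inf (zpow (-1)) * qpoch_inf q * spt_crank_gf =
    suminf (\<lambda>n. \<Sum>m=0..n. hecke_term n m)"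
proof (rule fps_eqI_cong)
  fix d :: nat
  \<comment> \<open>The bound of \<open>hecke_sum_cong\<close>; the left-hand side is truncated
    modulo q^B and then weakened to q^d, so that both double sums have the same ranges.\<close>
  define B where "B = 12 * d + 2"
  have "fps_cong d (qpoch_inf (zpow 1) * qpoch_inf (zpow (-1)) * qpoch_inf q * spt_crank_gf)
    (\<Sum>k<B. zweight (Suc k) * (\<Sum>j<B. q ^ (3 * j ^ 2 + j + 3 * j * Suc k) *
       (1 - q ^ (4 * j + 2 + 2 * Suc k))))"
    by (rule fps_cong_mono[OF product_spt_crank_gf_cong]) (simp add: B_def)
  also have "\<dots> = (\<Sum>k<B. \<Sum>m<6 * B. hecke_term (m + 2 * Suc k) m)"
    unfolding sum_hecke_term_residues hecke_term_pair sum_distrib_left ..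
  also have "fps_cong d \<dots> (suminf (\<lambda>n. \<Sum>m=0..n. hecke_term n m))"
    by (rule fps_cong_sym[OF hecke_sum_cong]) (simp add: B_def)
  finally show "fps_cong d
    (qpoch_inf (zpow 1) * qpoch_inf (zpow (-1)) * qpoch_inf q * spt_crank_gf)
    (suminf (\<lambda>n. \<Sum>m=0..n. hecke_term n m))" .
qed

end
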